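(* Consider the trustee-agent system described in the context. Assume there are positive constants $B$, $M$ and $V$ such that, for all time steps $t$, $$V\sum_{n,c}\mathbb E\{u_n^{(c)}(A_n^{(c)}(t))\mid\boldsymbol Q(t)\}-\Delta(t)\;\ge\; V U^{opt}+M\sum_{n,c}Q_n^{(c)}(t)-B,$$ and suppose that $\sum_{n,c}u_n^{(c)}(A_n^{(c)}(t))\le G_{max}$ for all $t$, for some constant $G_{max}$. Then $$\limsup_{T\to\infty}\frac1T\sum_{t=0}^{T-1}\sum_{n,c}\mathbb E\{Q_n^{(c)}(t)\}\;\le\;\frac{B+VG_{max}}{M}$$ and $$\liminf_{T\to\infty}\frac1T\sum_{t=0}^{T-1}\sum_{n,c}\mathbb E\{u_n^{(c)}(A_n^{(c)}(t))\}\;\ge\; U^{opt}-\frac BV .$$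
   Context: There are finitely many trustee agents $n$ and finitely many task types (contexts) $c$. Time is discrete, $t=0,1,2,\dots$. $Q_n^{(c)}(t)\ge 0$ is the (random) length of agent $n$'s queue of pending tasks of type $c$ at time $t$, and $\boldsymbol Q(t)=(Q_n^{(c)}(t))_{n,c}$. $A_n^{(c)}(t)\ge0$ is the number of new tasks of type $c$ that agent $n$ accepts at time $t$. $u_n^{(c)}(\cdot)\ge 0$ is the utility function of agent $n$ for tasks of type $c$; specifically $u_n^{(c)}(A_n^{(c)}(t))=A_n^{(c)}(t)\,\tau_n^{(c)}(t)\,G_{max}^{(c)}$, where $\tau_n^{(c)}(t)\in[0,1]$ is the reputation of $n$ for type $c$ and $G_{max}^{(c)}$ is the maximum payoff of a task of type $c$. The Lyapunov function is $L(\boldsymbol Q(t))=\sum_{n,c}(Q_n^{(c)}(t))^2$ and the conditional Lyapunov drift is $\Delta(t)=\mathbb E\{L(\boldsymbol Q(t+1))-L(\boldsymbol Q(t))\mid\boldsymbol Q(t)\}$. All expectations involved, including $\mathbb E\{L(\boldsymbol Q(t))\}$ for every $t$, are finite. $U^{opt}\ge 0$ is a fixed number, the social welfare (a sum of the non-negative utilities $u_n^{(c)}$) produced by the optimal solution of the problem of maximizing $\sum_{n,c}[V u_n^{(c)}(A_n^{(c)}(t))-Q_n^{(c)}(t)A_n^{(c)}(t)]$ subject to $\sum_c A_n^{(c)}(t)e^{(c)}\le e_n^{max}(t)$ and $0\le A_n^{(c)}(t)\le\lambda_n^{(c)}(t)$ for all $n,c,t$, where $e^{(c)}$ is the effort required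 for one task of type $c$, $e_n^{max}(t)$ is the maximum effort agent $n$ can expend at time $t$, and $\lambda_n^{(c)}(t)$ is the number of incoming requests of type $c$ received by $n$ at time $t$. *)

theory Defs
  imports "HOL-Probability.Probability"
begin

text \<open>Agents are the elements of the finite type \<open>'n\<close>, task types those of \<open>'c\<close>; the entry
  \<open>x $ n $ c\<close> of a vector \<open>x :: real^'c^'n\<close> belongs to agent \<open>n\<close> and type \<open>c\<close>.\<close>

definition utility :: "real^'c \<Rightarrow> real^'c^'n \<Rightarrow> real^'c^'n \<Rightarrow> 'n::finite \<Rightarrow> 'c::finite \<Rightarrow> real" where
  "utility G \<tau> a n c = a $ n $ c * \<tau> $ n $ c * G $ c"

definition social_welfare :: "real^'c::finite \<Rightarrow> real^'c^'n::finite \<Rightarrow> real^'c^'n \<Rightarrow> real" where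
  "social_welfare G \<tau> a = (\<Sum>n\<in>UNIV. \<Sum>c\<in>UNIV. utility G \<tau> a n c)"

definition lyapunov :: "real^'c::finite^'n::finite \<Rightarrow> real" where
  "lyapunov q = (\<Sum>n\<in>UNIV. \<Sum>c\<in>UNIV. (q $ n $ c)\<^sup>2)"

definition objective ::
  "real \<Rightarrow> real^'c::finite \<Rightarrow> real^'c^'n::finite \<Rightarrow> real^'c^'n \<Rightarrow> real^'c^'n \<Rightarrow> real" where
  "objective V G \<tau> q a =
     (\<Sum>n\<in>UNIV. \<Sum>c\<in>UNIV. V * utility G \<tau> a n c - q $ n $ c * a $ n $ c)"

definition feasible ::
  "real^'c::finite \<Rightarrow> real^'n::finite \<Rightarrow> real^'c^'n \<Rightarrow> real^'c^'n \<Rightarrow> bool" where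
  "feasible e e_max \<Lambda> a \<longleftrightarrow>
     (\<forall>n. (\<Sum>c\<in>UNIV. a $ n $ c * e $ c) \<le> e_max $ n) \<and>
     (\<forall>n c. 0 \<le> a $ n $ c \<and> a $ n $ c \<le> \<Lambda> $ n $ c)"

locale trustee_system = prob_space P
  for P :: "'w measure" +
  fixes Q :: "nat \<Rightarrow> 'w \<Rightarrow> real^'c::finite^'n::finite"
    and A :: "nat \<Rightarrow> 'w \<Rightarrow> real^'c^'n"
    and \<tau> :: "nat \<Rightarrow> 'w \<Rightarrow> real^'c^'n"
    and G :: "real^'c"
    and e_max :: "nat \<Rightarrow> 'w \<Rightarrow> real^'n"
    and \<Lambda> :: "nat \<Rightarrow> 'w \<Rightarrow> real^'c^'n"
  assumes random_variables:
      "random_variable borel (Q t)" "random_variable borel (A t)"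
      "random_variable borel (\<tau> t)" "random_variable borel (e_max t)"
      "random_variable borel (\<Lambda> t)"
    and Q_nonneg: "\<omega> \<in> space P \<Longrightarrow> 0 \<le> Q t \<omega> $ n $ c"
    and A_nonneg: "\<omega> \<in> space P \<Longrightarrow> 0 \<le> A t \<omega> $ n $ c"
    and reputation: "\<omega> \<in> space P \<Longrightarrow> \<tau> t \<omega> $ n $ c \<in> {0..1}"
    and payoff_nonneg: "0 \<le> G $ c"
    and integrable_Q: "integrable P (\<lambda>\<omega>. Q t \<omega> $ n $ c)"
    and integrable_lyapunov: "integrable P (\<lambda>\<omega>. lyapunov (Q t \<omega>))"
    and integrable_utility: "integrable P (\<lambda>\<omega>. utility G (\<tau> t \<omega>) (A t \<omega>) n c)"

definition queue_algebra :: "'w measure \<Rightarrow> ('w \<Rightarrow> real^'c::finite^'n::finite) \<Rightarrow> 'w measure" where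
  "queue_algebra P q = vimage_algebra (space P) q borel"

definition drift ::
  "'w measure \<Rightarrow> (nat \<Rightarrow> 'w \<Rightarrow> real^'c::finite^'n::finite) \<Rightarrow> nat \<Rightarrow> 'w \<Rightarrow> real" where
  "drift P Q t =
     real_cond_exp P (queue_algebra P (Q t)) (\<lambda>\<omega>. lyapunov (Q (Suc t) \<omega>) - lyapunov (Q t \<omega>))"

text \<open>The optimization problem depends on the time and on the random state, hence so does the social
  welfare produced by its solution. The fixed number \<open>U\<close> is the long-run average of the expected
  welfare; if the welfare produced is the same constant at all times, it is that constant.\<close>

definition optimal_welfare ::
  "'w measure \<Rightarrow> real \<Rightarrow> (nat \<Rightarrow> 'w \<Rightarrow> real^'c::finite^'n::finite) \<Rightarrow> (nat \<Rightarrow> 'w \<Rightarrow> real^'c^'n) \<Rightarrow>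
   real^'c \<Rightarrow> real^'c \<Rightarrow> (nat \<Rightarrow> 'w \<Rightarrow> real^'n) \<Rightarrow> (nat \<Rightarrow> 'w \<Rightarrow> real^'c^'n) \<Rightarrow> real \<Rightarrow> bool" where
  "optimal_welfare P V Q \<tau> G e e_max \<Lambda> U \<longleftrightarrow>
     (\<exists>A_opt.
        (\<forall>t. A_opt t \<in> borel_measurable P) \<and>
        (\<forall>t. AE \<omega> in P. is_arg_max (objective V G (\<tau> t \<omega>) (Q t \<omega>))
                          (feasible e (e_max t \<omega>) (\<Lambda> t \<omega>)) (A_opt t \<omega>)) \<and>
        (\<forall>t. integrable P (\<lambda>\<omega>. social_welfare G (\<tau> t \<omega>) (A_opt t \<omega>))) \<and>
        (\<lambda>T. 1 / real T * (\<Sum>t<T. prob_space.expectation P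
               (\<lambda>\<omega>. social_welfare G (\<tau> t \<omega>) (A_opt t \<omega>)))) \<longlonglongrightarrow> U)"

end

theory Submission
  imports Defs
begin

text \<open>Taking expectations removes the conditioning in the drift condition, so the expected welfare
  \<open>w\<close>, total backlog \<open>q\<close> and Lyapunov function \<open>L\<close> satisfy
  \<open>V * U + M * q t - B \<le> V * w t - (L (t + 1) - L t)\<close>. Summing over \<open>t < T\<close> telescopes the drift;
  since \<open>L \<ge> 0\<close>, dividing by \<open>T\<close> leaves an error of at most \<open>L 0 / T\<close>.\<close>

text \<open>The error \<open>b / real T\<close> tends to 0, and upper limits are monotone whether or
  not \<open>f\<close> converges. The bound is asked only for positive \<open>T\<close>, because
  division by \<open>real 0\<close> has merely a default value.\<close>

lemma limsup_le_const_plus_inverse: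
  fixes f :: "nat \<Rightarrow> real"
  assumes "\<And>T. 0 < T \<Longrightarrow> f T \<le> a + b / real T"
  shows "limsup (\<lambda>T. ereal (f T)) \<le> ereal a"
proof -
  have "(\<lambda>T. a + b / real T) \<longlonglongrightarrow> a + 0"
    by (intro tendsto_add tendsto_const lim_const_over_n)
  then have "limsup (\<lambda>T. ereal (a + b / real T)) = ereal a"
    by (intro lim_imp_Limsup) auto
  moreover have "limsup (\<lambda>T. ereal (f T)) \<le> limsup (\<lambda>T. ereal (a + b / real T))"
    using assms by (intro Limsup_mono eventually_mono[OF eventually_gt_at_top[of 0]]) simp
  ultimately show ?thesis by simp
qed

lemma liminf_ge_const_minus_inverse:
  fixes f :: "nat \<Rightarrow> real"
  assumes "\<And>T. 0 < T \<Longrightarrow> a - b / real T \<le> f T"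
  shows "ereal a \<le> liminf (\<lambda>T. ereal (f T))"
proof -
  have "(\<lambda>T. a - b / real T) \<longlonglongrightarrow> a - 0"
    by (intro tendsto_diff tendsto_const lim_const_over_n)
  then have "liminf (\<lambda>T. ereal (a - b / real T)) = ereal a"
    by (intro lim_imp_Liminf) auto
  moreover have "liminf (\<lambda>T. ereal (a - b / real T)) \<le> liminf (\<lambda>T. ereal (f T))"
    using assms by (intro Liminf_mono eventually_mono[OF eventually_gt_at_top[of 0]]) simp
  ultimately show ?thesis by simp
qed

text \<open>The deterministic core: one telescoped inequality gives both averages. Discarding the
  \<open>U\<close> term and bounding \<open>w\<close> by \<open>G\<close> controls the backlog;
  discarding the backlog term controls the welfare.\<close>

lemma lyapunov_drift_time_averages:
  fixes w q L :: "nat \<Rightarrow> real"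
  assumes drift: "\<And>t. V * U + M * q t - B \<le> V * w t - (L (Suc t) - L t)"
    and w_le: "\<And>t. w t \<le> G"
    and nonneg: "0 \<le> U" "\<And>t. 0 \<le> q t" "\<And>t. 0 \<le> L t"
    and pos: "0 < M" "0 < V"
  shows "limsup (\<lambda>T. ereal (1 / real T * (\<Sum>t<T. q t))) \<le> ereal ((B + V * G) / M)"
    and "ereal (U - B / V) \<le> liminf (\<lambda>T. ereal (1 / real T * (\<Sum>t<T. w t)))"
proof -
  have telescoped:
    "real T * (V * U) + M * (\<Sum>t<T. q t) - real T * B \<le> V * (\<Sum>t<T. w t) + L 0" for T
  proof -
    have "(\<Sum>t<T. V * U + M * q t - B) \<le> (\<Sum>t<T. V * w t - (L (Suc t) - L t))"
      by (intro sum_mono drift)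
    \<comment> \<open>Only the outer difference is split, so that the sum of
      \<open>L (Suc t) - L t\<close> stays whole and matches the telescoping identity.\<close>
    also have "\<dots> = V * (\<Sum>t<T. w t) - (L T - L 0)"
      using sum_lessThan_telescope[of L T]
      by (simp add: sum_subtractf[of "\<lambda>t. V * w t"] sum_distrib_left del: sum_subtractf)
    \<comment> \<open>Nonnegativity of \<open>L T\<close> allows it to be dropped, leaving only the
      initial value \<open>L 0\<close>.\<close>
    finally show ?thesis
      using nonneg(3)[of T] by (simp add: sum.distrib sum_subtractf sum_distrib_left)
  qed
  show "limsup (\<lambda>T. ereal (1 / real T * (\<Sum>t<T. q t))) \<le> ereal ((B + V * G) / M)"
  \<comment> \<open>Division by \<open>M * real T\<close> turns the leftover \<open>L 0\<close> into
    the error \<open>L 0 / M / real T\<close>.\<close>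
  proof (rule limsup_le_const_plus_inverse[where b = "L 0 / M"])
    fix T :: nat
    assume T: "0 < T"
    have "(\<Sum>t<T. w t) \<le> real T * G"
      using sum_bounded_above[of "{..<T}" w G] w_le by simp
    then have "V * (\<Sum>t<T. w t) \<le> V * (real T * G)"
      using pos by simp
    moreover have "0 \<le> real T * (V * U)"
      using pos nonneg by simp
    ultimately have "M * (\<Sum>t<T. q t) \<le> real T * (B + V * G) + L 0"
      using telescoped[of T] by (simp add: algebra_simps)
    then show "1 / real T * (\<Sum>t<T. q t) \<le> (B + V * G) / M + L 0 / M / real T"
      using T pos by (simp add: field_simps)
  qed
  show "ereal (U - B / V) \<le> liminf (\<lambda>T. ereal (1 / real T * (\<Sum>t<T. w t)))"
  proof (rule liminf_ge_const_minus_inverse[where b = "L 0 / V"])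
    fix T :: nat
    assume T: "0 < T"
    have "0 \<le> M * (\<Sum>t<T. q t)"
      using pos nonneg by (simp add: sum_nonneg)
    then have "real T * (V * U) - real T * B - L 0 \<le> V * (\<Sum>t<T. w t)"
      using telescoped[of T] by simp
    then have "(real T * (V * U) - real T * B - L 0) / (V * real T)
        \<le> V * (\<Sum>t<T. w t) / (V * real T)"
      using pos by (intro divide_right_mono) simp_all
    then show "U - B / V - L 0 / V / real T \<le> 1 / real T * (\<Sum>t<T. w t)"
      using T pos by (simp add: diff_divide_distrib)
  qed
qed

text \<open>Preimages of Borel sets under a measurable \<open>q\<close> are events, so conditioning
  on the queue is conditioning on a sub-sigma-algebra, as the rules for conditional expectation
  require.\<close>

lemma subalgebra_queue_algebra:
  assumes "q \<in> borel_measurable P"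
  shows "subalgebra P (queue_algebra P q)"
  using assms unfolding subalgebra_def queue_algebra_def
  by (auto simp: sets_vimage_algebra2 measurable_sets)

theorem mainTheorem4:
  fixes P :: "'w measure"
    and Q A \<tau> \<Lambda> :: "nat \<Rightarrow> 'w \<Rightarrow> real^'c::finite^'n::finite"
    and G e :: "real^'c"
    and e_max :: "nat \<Rightarrow> 'w \<Rightarrow> real^'n"
    and B M V U_opt G_max :: real
  assumes system: "trustee_system P Q A \<tau> G e_max \<Lambda>"
    and U_opt_nonneg: "0 \<le> U_opt"
    and U_opt: "optimal_welfare P V Q \<tau> G e e_max \<Lambda> U_opt"
    and pos: "0 < B" "0 < M" "0 < V"
    and drift_bound:
      "\<And>t. AE \<omega> in P.
         V * (\<Sum>n\<in>UNIV. \<Sum>c\<in>UNIV.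
                real_cond_exp P (queue_algebra P (Q t)) (\<lambda>\<omega>. utility G (\<tau> t \<omega>) (A t \<omega>) n c) \<omega>)
           - drift P Q t \<omega>
         \<ge> V * U_opt + M * (\<Sum>n\<in>UNIV. \<Sum>c\<in>UNIV. Q t \<omega> $ n $ c) - B"
    and welfare_bound:
      "\<And>t. AE \<omega> in P. (\<Sum>n\<in>UNIV. \<Sum>c\<in>UNIV. utility G (\<tau> t \<omega>) (A t \<omega>) n c) \<le> G_max"
  shows "limsup (\<lambda>T. ereal (1 / real T * (\<Sum>t<T. \<Sum>n\<in>UNIV. \<Sum>c\<in>UNIV.
             prob_space.expectation P (\<lambda>\<omega>. Q t \<omega> $ n $ c))))
           \<le> ereal ((B + V * G_max) / M)
       \<and> liminf (\<lambda>T. ereal (1 / real T * (\<Sum>t<T. \<Sum>n\<in>UNIV. \<Sum>c\<in>UNIV.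
             prob_space.expectation P (\<lambda>\<omega>. utility G (\<tau> t \<omega>) (A t \<omega>) n c))))
           \<ge> ereal (U_opt - B / V)"
proof -
  interpret trustee_system P Q A \<tau> G e_max \<Lambda> by (fact system)
  define w where "w t = (\<Sum>n\<in>UNIV. \<Sum>c\<in>UNIV. expectation (\<lambda>\<omega>. utility G (\<tau> t \<omega>) (A t \<omega>) n c))" for t
  define q where "q t = (\<Sum>n\<in>UNIV. \<Sum>c\<in>UNIV. expectation (\<lambda>\<omega>. Q t \<omega> $ n $ c))" for t
  define L where "L t = expectation (\<lambda>\<omega>. lyapunov (Q t \<omega>))" for t
  note integrable = integrable_Q integrable_utility integrable_lyapunov
  have "V * U_opt + M * q t - B \<le> V * w t - (L (Suc t) - L t)" for t
  proof -
    interpret F: finite_measure_subalgebra P "queue_algebra P (Q t)"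
      by unfold_locales (intro subalgebra_queue_algebra random_variables)
    \<comment> \<open>The first part is integrability of the conditional expectation; the second
      equates its integral with that of the original function and so removes the
      conditioning.\<close>
    note cond_exp = F.real_cond_exp_int
    have "V * U_opt + M * q t - B = expectation (\<lambda>\<omega>. V * U_opt
        + M * (\<Sum>n\<in>UNIV. \<Sum>c\<in>UNIV. Q t \<omega> $ n $ c) - B)"
      by (simp add: q_def integrable prob_space)
    also have "\<dots> \<le> expectation (\<lambda>\<omega>. V * (\<Sum>n\<in>UNIV. \<Sum>c\<in>UNIV.
        real_cond_exp P (queue_algebra P (Q t)) (\<lambda>\<omega>. utility G (\<tau> t \<omega>) (A t \<omega>) n c) \<omega>)
        - drift P Q t \<omega>)"
      \<comment> \<open>Conditional expectations are determined only up to null sets, hence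
        monotonicity in its almost-everywhere form.\<close>
      unfolding drift_def
      by (intro integral_mono_AE drift_bound[unfolded drift_def] Bochner_Integration.integrable_add
          Bochner_Integration.integrable_diff integrable_mult_right Bochner_Integration.integrable_sum
          integrable_const integrable cond_exp(1))
    also have "\<dots> = V * w t - (L (Suc t) - L t)"
      by (simp add: drift_def w_def L_def integrable cond_exp)
    finally show ?thesis .
  qed
  moreover have "w t \<le> G_max" for t
  proof -
    \<comment> \<open>The sums move inside the expectation because \<open>welfare_bound\<close>
      controls the total utility rather than each summand.\<close>
    have "w t = expectation (\<lambda>\<omega>. \<Sum>n\<in>UNIV. \<Sum>c\<in>UNIV. utility G (\<tau> t \<omega>) (A t \<omega>) n c)"
      by (simp add: w_def integrable)
    also have "\<dots> \<le> G_max"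
      by (intro integral_le_const welfare_bound Bochner_Integration.integrable_sum integrable)
    finally show ?thesis .
  qed
  moreover have "0 \<le> q t" for t
    unfolding q_def by (intro sum_nonneg Bochner_Integration.integral_nonneg Q_nonneg)
  moreover have "0 \<le> L t" for t
    unfolding L_def by (intro Bochner_Integration.integral_nonneg) (simp add: lyapunov_def sum_nonneg)
  ultimately show ?thesis
    using lyapunov_drift_time_averages[of V U_opt M q B w L G_max] U_opt_nonneg pos
    by (simp add: w_def q_def)
qed

end
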